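(* Fix $x \in \mathbb{R} \setminus \mathbb{Z}$. Then there is a constant $C_x > 0$, depending only on $x$, such that for every positive integer $q > 2\pi|x|$, $$\left| \tilde c_q(x) - \frac{e^{2\pi i x} - 1}{2\pi i x}\,\varphi(q) \right| \le C_x\, \sigma_0(q),$$ i.e. $\tilde c_q(x) = \frac{e^{2\pi i x} - 1}{2\pi i x}\varphi(q) + O_x(\sigma_0(q))$ for all $q > 2\pi|x|$.
   Context: For a positive integer $q$ and real $x$, the real-variable Ramanujan sum is $\tilde c_q(x) = \sum_{k \in (\mathbb{Z}/q\mathbb{Z})^\times} e^{2\pi i k x/q}$, the sum over $1 \le k \le q$ with $\gcd(k,q)=1$. $\varphi$ is Euler's totient function and $\sigma_0(q)$ is the number of positive divisors of $q$. The notation $f = O_x(g)$ means $|f| \le C_x g$ for some constant $C_x > 0$ depending only on $x$. *)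

theory Defs
  imports "HOL-Analysis.Analysis" "HOL-Number_Theory.Totient"
begin

definition real_ramanujan_sum :: "nat \<Rightarrow> real \<Rightarrow> complex" where
  "real_ramanujan_sum q x =
     (\<Sum>k\<in>totatives q. exp (2 * of_real pi * \<i> * of_nat k * of_real x / of_nat q))"

(* For q = 0 the set is infinite and the value is 0. *)
definition sigma0 :: "nat \<Rightarrow> nat" where
  "sigma0 q = card {d. d dvd q}"

end

(* Sieving by the primes dividing q, i.e. inclusion-exclusion over the squarefree
   divisors d of q, reduces the sum over totatives to at most sigma0 q complete sums
   over k = 1, ..., n with n = q/d.  Each complete sum of exp (2 pi i x k / n) is a
   Riemann sum for n times the integral of exp (2 pi i x t) over [0, 1], and its error
   is bounded independently of n. *)
theory Submission
  imports Defs
begin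

text \<open>Sieving out one more prime p subtracts the multiples of p from the sum over
  \<open>n\<close>. Since \<open>h\<close> sees only the ratio k/n, these multiples form a sum of
  the same shape over n/p, so each prime at most doubles the bound. The induction therefore has to
  cover all \<open>n\<close> at once.\<close>

lemma norm_sum_sifted_le:
  fixes h :: "real \<Rightarrow> 'a::real_normed_vector" and B :: real
  assumes B: "\<And>n. n > 0 \<Longrightarrow> norm (\<Sum>k\<in>{0<..n}. h (real k / real n)) \<le> B"
    and "finite P" "\<And>p. p \<in> P \<Longrightarrow> prime p" "\<And>p. p \<in> P \<Longrightarrow> p dvd n" "n > 0"
  shows "norm (\<Sum>k\<in>{k \<in> {0<..n}. \<forall>p\<in>P. \<not> p dvd k}. h (real k / real n)) \<le> 2 ^ card P * B"
  using assms(2-)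
proof (induction P arbitrary: n rule: finite_induct)
  case empty
  have "{k \<in> {0<..n}. \<forall>p\<in>{}. \<not> p dvd k} = {0<..n}" by auto
  then show ?case using B[of n] empty by simp
next
  case (insert p P n)
  define S where "S m = {k \<in> {0<..m}. \<forall>r\<in>P. \<not> r dvd k}" for m :: nat
  have p: "prime p" "p > 0" using insert.prems(1)[of p] by (auto simp: prime_gt_0_nat)
  obtain m where n: "n = p * m" using insert.prems(2)[of p] by blast
  have m: "m > 0" using insert.prems(3) n by simp
  \<comment> \<open>Distinct primes are coprime, so the conditions imposed by \<open>P\<close> do
    not notice a factor \<open>p\<close>. This identifies the multiples of \<open>p\<close> in
    \<open>S n\<close> with \<open>S m\<close>, and it also shows that the primes in
    \<open>P\<close> still divide \<open>m\<close>, as the induction hypothesis at \<open>m\<close>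
    requires.\<close>
  have r_dvd: "r dvd p * k \<longleftrightarrow> r dvd k" if "r \<in> P" for r k
  proof (rule coprime_dvd_mult_right_iff)
    show "coprime r p"
      using that insert.hyps insert.prems(1) by (intro primes_coprime) auto
  qed
  have multiples: "{k \<in> S n. p dvd k} = (*) p ` S m"
  proof -
    have "p * k \<in> S n \<longleftrightarrow> k \<in> S m" for k
      using p r_dvd by (simp add: S_def n)
    then show ?thesis by (auto elim!: dvdE)
  qed
  have "(\<Sum>k\<in>{k \<in> S n. p dvd k}. h (real k / real n)) = (\<Sum>k\<in>S m. h (real k / real m))"
    unfolding multiples by (subst sum.reindex) (use p in \<open>simp_all add: inj_on_def n\<close>)
  moreover have "(\<Sum>k\<in>S n. h (real k / real n)) =
      (\<Sum>k\<in>{k \<in> S n. \<not> p dvd k}. h (real k / real n)) + (\<Sum>k\<in>{k \<in> S n. p dvd k}. h (real k / real n))"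
    by (subst sum.union_disjoint[symmetric]) (auto simp: S_def intro!: sum.cong)
  moreover have "{k \<in> {0<..n}. \<forall>r\<in>insert p P. \<not> r dvd k} = {k \<in> S n. \<not> p dvd k}"
    by (auto simp: S_def)
  ultimately have "(\<Sum>k\<in>{k \<in> {0<..n}. \<forall>r\<in>insert p P. \<not> r dvd k}. h (real k / real n)) =
      (\<Sum>k\<in>S n. h (real k / real n)) - (\<Sum>k\<in>S m. h (real k / real m))"
    by simp
  also have "norm \<dots> \<le> 2 ^ card P * B + 2 ^ card P * B"
  proof (rule order.trans[OF norm_triangle_ineq4 add_mono])
    show "norm (\<Sum>k\<in>S n. h (real k / real n)) \<le> 2 ^ card P * B"
      unfolding S_def using insert.prems by (intro insert.IH) auto
    show "norm (\<Sum>k\<in>S m. h (real k / real m)) \<le> 2 ^ card P * B"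
      unfolding S_def using insert.prems(1,2) m r_dvd n by (intro insert.IH) auto
  qed
  finally show ?case using insert.hyps by (simp add: mult_ac)
qed

lemma totatives_eq_sifted:
  assumes "q > 0"
  shows "totatives q = {k \<in> {0<..q}. \<forall>p\<in>prime_factors q. \<not> p dvd k}"
proof -
  have "coprime k q \<longleftrightarrow> (\<forall>p\<in>prime_factors q. \<not> p dvd k)" for k
  proof
    assume "coprime k q"
    then show "\<forall>p\<in>prime_factors q. \<not> p dvd k"
      by (metis coprime_common_divisor in_prime_factors_iff not_prime_unit)
  next
    assume *: "\<forall>p\<in>prime_factors q. \<not> p dvd k"
    show "coprime k q"
    proof (rule ccontr)
      assume "\<not> coprime k q"
      then have "gcd k q \<noteq> 1" by (simp add: coprime_iff_gcd_eq_1)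
      then obtain p where "prime p" "p dvd gcd k q" using prime_factor_nat by blast
      then show False using * assms by (auto simp: in_prime_factors_iff)
    qed
  qed
  then show ?thesis by (auto simp: totatives_def)
qed

text \<open>Each set of primes dividing \<open>q\<close> has a squarefree divisor of
  \<open>q\<close> as its product, and unique factorization recovers the set from that
  product.\<close>

lemma two_power_card_prime_factors_le:
  assumes "q > 0"
  shows "2 ^ card (prime_factors q) \<le> sigma0 q"
proof -
  have pf: "prime_factors (\<Prod>S) = S" if "S \<subseteq> prime_factors q" for S
  proof -
    have fin: "finite S" using that finite_subset by auto
    have pr: "prime p" if "p \<in> S" for p using that \<open>S \<subseteq> prime_factors q\<close> by auto
    have "0 \<notin> S" using pr by (metis not_prime_0)
    have "prime_factors (prod id S) = (\<Union>p\<in>S. prime_factors p)"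
      using fin \<open>0 \<notin> S\<close> by (subst prime_factors_prod) (auto simp: image_iff)
    also have "\<dots> = S" using pr by (auto simp: prime_factorization_prime)
    finally show ?thesis by simp
  qed
  have "\<Prod>S dvd q" if S: "S \<subseteq> prime_factors q" for S
  proof -
    have "\<Prod>S dvd \<Prod>(prime_factors q)" using S by (intro prod_dvd_prod_subset) auto
    \<comment> \<open>Every prime factor occurs in \<open>q\<close> with exponent at least
      1.\<close>
    also have "\<dots> dvd (\<Prod>p\<in>prime_factors q. p ^ multiplicity p q)"
      by (intro prod_dvd_prod dvd_power) (auto simp: prime_factors_multiplicity)
    also have "\<dots> = q" using assms by (simp add: prime_factorization_nat[symmetric])
    finally show ?thesis .
  qed
  then have "(\<lambda>S. \<Prod>S) ` Pow (prime_factors q) \<subseteq> {d. d dvd q}" by blast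
  moreover have "inj_on (\<lambda>S. \<Prod>S) (Pow (prime_factors q))"
    using pf by (intro inj_on_inverseI[where g = prime_factors]) blast
  moreover have "finite {d. d dvd q}" using assms by simp
  ultimately have "card (Pow (prime_factors q)) \<le> card {d. d dvd q}"
    by (intro card_inj_on_le)
  then show ?thesis by (simp add: card_Pow sigma0_def)
qed

lemma norm_sum_totatives_le:
  fixes h :: "real \<Rightarrow> 'a::real_normed_vector" and B :: real
  assumes B: "\<And>n. n > 0 \<Longrightarrow> norm (\<Sum>k\<in>{0<..n}. h (real k / real n)) \<le> B" and q: "q > 0"
  shows "norm (\<Sum>k\<in>totatives q. h (real k / real q)) \<le> B * real (sigma0 q)"
proof -
  \<comment> \<open>The hypothesis at n = 1 forces \<open>B\<close> to be nonnegative, so that 2 to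
    the number of prime factors may be replaced by the larger \<open>sigma0 q\<close> in front of
    \<open>B\<close>.\<close>
  have "0 \<le> norm (\<Sum>k\<in>{0<..Suc 0}. h (real k / real (Suc 0)))" by (rule norm_ge_zero)
  also have "\<dots> \<le> B" by (rule B) simp
  finally have "B \<ge> 0" .
  have "norm (\<Sum>k\<in>totatives q. h (real k / real q)) \<le> 2 ^ card (prime_factors q) * B"
    unfolding totatives_eq_sifted[OF q] by (rule norm_sum_sifted_le[OF B]) (use q in auto)
  also have "\<dots> \<le> real (sigma0 q) * B"
  proof (rule mult_right_mono[OF _ \<open>B \<ge> 0\<close>])
    show "2 ^ card (prime_factors q) \<le> real (sigma0 q)"
      using of_nat_mono[OF two_power_card_prime_factors_le[OF q], where 'a = real] by simp
  qed
  finally show ?thesis by (simp only: mult.commute)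
qed

text \<open>The number (exp c - 1) / c is the mean of exp (c t) over [0, 1]. On each of the n
  intervals of length 1/n, the right endpoint value differs from the local mean by at most |c| / n,
  because exp (c t) has modulus 1 for imaginary \<open>c\<close>. The n errors add up to at most
  |c|.\<close>

lemma norm_Riemann_sum_exp_diff_le:
  fixes c :: complex
  assumes "Re c = 0" "c \<noteq> 0" "n > 0"
  shows "norm (\<Sum>k\<in>{0<..n}. exp (c * of_real (real k / real n)) - (exp c - 1) / c) \<le> norm c"
proof -
  define z where "z = c / of_nat n"
  have z: "z \<noteq> 0" "Re z = 0" using assms by (auto simp: z_def)
  define G where "G k = exp (of_nat k * z)" for k :: nat
  have normG: "norm (G k) = 1" for k using z by (simp add: G_def)
  have "(\<Sum>k\<in>{0<..n}. exp (c * of_real (real k / real n)) - (exp c - 1) / c)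
      = (\<Sum>k<n. G (Suc k)) - of_nat n * ((G n - G 0) / c)"
  proof -
    have "(\<Sum>k\<in>{0<..n}. exp (c * of_real (real k / real n))) = (\<Sum>k<n. G (Suc k))"
      by (rule sum.reindex_bij_witness[of _ Suc "\<lambda>k. k - 1"])
         (auto simp: G_def z_def mult.commute)
    then show ?thesis using assms by (simp add: sum_subtractf G_def z_def)
  qed
  also have "of_nat n * ((G n - G 0) / c) = (G n - G 0) / z"
    using assms by (simp add: z_def)
  \<comment> \<open>Telescoping splits the integral: the k-th term is the mean of exp (c t) over
    [k/n, (k+1)/n].\<close>
  also have "\<dots> = (\<Sum>k<n. (G (Suc k) - G k) / z)"
    by (simp add: sum_lessThan_telescope flip: sum_divide_distrib)
  also have "norm ((\<Sum>k<n. G (Suc k)) - \<dots>) \<le> (\<Sum>k<n. norm z)"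
    unfolding sum_subtractf[symmetric]
  proof (rule sum_norm_le)
    fix k
    have "G k = G (Suc k) * exp (- z)"
      by (simp add: G_def ring_distribs flip: exp_add)
    \<comment> \<open>Factoring out the unimodular \<open>G (Suc k)\<close> leaves the first-order
      Taylor remainder of exp at \<open>- z\<close>, divided by \<open>z\<close>. As
      \<open>- z\<close> is imaginary, that remainder is at most |z|^2.\<close>
    then have "G (Suc k) - (G (Suc k) - G k) / z = G (Suc k) * (exp (- z) - (\<Sum>i\<le>1. (- z) ^ i / fact i)) / z"
      using z by (simp add: field_simps)
    also have "norm \<dots> = norm (exp (- z) - (\<Sum>i\<le>1. (- z) ^ i / fact i)) / norm z"
      by (simp only: norm_mult norm_divide normG mult_1)
    also have "\<dots> \<le> norm z ^ 2 / norm z"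
      using Taylor_exp[of "- z" 1] z by (intro divide_right_mono) (auto simp: power2_eq_square)
    also have "\<dots> = norm z" using z by (simp add: power2_eq_square)
    finally show "norm (G (Suc k) - (G (Suc k) - G k) / z) \<le> norm z" .
  qed
  also have "\<dots> = norm c" using assms by (simp add: z_def norm_divide)
  finally show ?thesis .
qed

theorem theorem1:
  fixes x :: real
  assumes "x \<notin> \<int>"
  shows "\<exists>C::real. C > 0 \<and>
           (\<forall>q::nat. q > 0 \<and> real q > 2 * pi * \<bar>x\<bar> \<longrightarrow>
              norm (real_ramanujan_sum q x
                    - (exp (2 * of_real pi * \<i> * of_real x) - 1) / (2 * of_real pi * \<i> * of_real x)
                      * of_nat (totient q))
                \<le> C * real (sigma0 q))"
proof -
  define c :: complex where "c = 2 * of_real pi * \<i> * of_real x"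
  have c: "c \<noteq> 0" "Re c = 0" using assms by (auto simp: c_def)
  have "norm (real_ramanujan_sum q x - (exp c - 1) / c * of_nat (totient q)) \<le> norm c * real (sigma0 q)"
    if "q > 0" for q
  proof -
    \<comment> \<open>The sieve is applied to h(t) = exp (c t) minus its mean over [0, 1]. Summed
      over the totatives, the subtracted constant gives the main term with factor
      \<open>totient q\<close>.\<close>
    have "norm (\<Sum>k\<in>totatives q. exp (c * of_real (real k / real q)) - (exp c - 1) / c)
        \<le> norm c * real (sigma0 q)"
      by (rule norm_sum_totatives_le[OF norm_Riemann_sum_exp_diff_le[OF c(2,1)] that])
    also have "(\<Sum>k\<in>totatives q. exp (c * of_real (real k / real q)) - (exp c - 1) / c)
        = real_ramanujan_sum q x - (exp c - 1) / c * of_nat (totient q)"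
      by (simp add: sum_subtractf real_ramanujan_sum_def totient_def c_def mult_ac)
    finally show ?thesis .
  qed
  then show ?thesis using c unfolding c_def[symmetric]
    \<comment> \<open>The constant is |c| = 2 pi |x|, which depends on \<open>x\<close>
      alone.\<close>
    by (intro exI[of _ "norm c"]) auto
qed

end
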